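(* Let $X$ be a Banach space with topological dual $X^*$. Let $K$ be a convex subset of $X$ with $\mathrm{cor}\,K\neq\emptyset$ and let the set-valued map $T:X\rightrightarrows X^*$ be quasimonotone and weakly dually lower semicontinuous on $K$. If $S(T,K)\nsubseteq M(T,K)$, then there exists $x\in X$ with $0\in T(x)$.
   Context: $X$ is a (real) Banach space, $X^*$ its topological dual, $\langle\cdot,\cdot\rangle$ the duality pairing; $\rightharpoonup$ denotes weak convergence. Convention: $\inf\emptyset=+\infty$. The algebraic interior of $K$ is $\mathrm{cor}\,K=\{y\in K:\ \forall x\in X\ \exists\lambda>0\ \forall t\in[0,\lambda),\ y+tx\in K\}$. $T$ is quasimonotone on $K$ if for all $x,y\in K$: if there is $x^*\in T(x)$ with $\langle x^*,y-x\rangle>0$, then $\langle y^*,y-x\rangle\ge 0$ for all $y^*\in T(y)$. $T$ is weakly dually lower semicontinuous on $K$ if for any $x\in K$ and any net $(y_\alpha)_\alpha\subseteq K$ with $y_\alpha\rightharpoonup y$: if $\limsup_\alpha\inf_{y_\alpha^*\in T(y_\alpha)}\langle y_\alpha^*,y_\alpha-x\rangle\ge 0$, then $\inf_{y^*\in T(y)}\langle y^*,y-x\rangle\ge 0$. $S(T,K)=\{x\in K:\ \exists x^*\in T(x)\text{ with }\langle x^*,y-x\rangle\ge 0\ \forall y\in K\}$ (Stampacchia solutions). $M(T,K)=\{x\in K:\ \langle y^*,y-x\rangle\ge 0\ \ \forall y\in K,\ \forall y^*\in T(y)\}$ (Minty solutions). *)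

theory Defs
  imports "HOL-Analysis.Analysis"
begin

text \<open>
  Throughout, the dual of X is the type \<open>'a \<Rightarrow>\<^sub>L real\<close> of bounded linear functionals, and a
  set-valued map from X to its dual is a function \<open>T :: 'a \<Rightarrow> ('a \<Rightarrow>\<^sub>L real) set\<close>, defined on the
  whole space; \<open>T x\<close> may be empty.
\<close>

definition cor :: "'a::real_vector set \<Rightarrow> 'a set" where
  "cor K = {y \<in> K. \<forall>x. \<exists>l>0. \<forall>t\<in>{0..<l}. y + t *\<^sub>R x \<in> K}"

definition quasimonotone_on ::
    "('a::real_normed_vector \<Rightarrow> ('a \<Rightarrow>\<^sub>L real) set) \<Rightarrow> 'a set \<Rightarrow> bool" where
  "quasimonotone_on T K \<longleftrightarrow>
     (\<forall>x\<in>K. \<forall>y\<in>K.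
        (\<exists>xs\<in>T x. blinfun_apply xs (y - x) > 0) \<longrightarrow>
        (\<forall>ys\<in>T y. blinfun_apply ys (y - x) \<ge> 0))"

definition stampacchia ::
    "('a::real_normed_vector \<Rightarrow> ('a \<Rightarrow>\<^sub>L real) set) \<Rightarrow> 'a set \<Rightarrow> 'a set" where
  "stampacchia T K = {x \<in> K. \<exists>xs\<in>T x. \<forall>y\<in>K. blinfun_apply xs (y - x) \<ge> 0}"

definition minty ::
    "('a::real_normed_vector \<Rightarrow> ('a \<Rightarrow>\<^sub>L real) set) \<Rightarrow> 'a set \<Rightarrow> 'a set" where
  "minty T K = {x \<in> K. \<forall>y\<in>K. \<forall>ys\<in>T y. blinfun_apply ys (y - x) \<ge> 0}"

definition weakly_tendsto ::
    "('i \<Rightarrow> 'a::real_normed_vector) \<Rightarrow> 'a \<Rightarrow> 'i filter \<Rightarrow> bool" where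
  "weakly_tendsto u y F \<longleftrightarrow>
     (\<forall>f :: 'a \<Rightarrow>\<^sub>L real. ((\<lambda>i. blinfun_apply f (u i)) \<longlongrightarrow> blinfun_apply f y) F)"

text \<open>Extended-real valued, so that the infimum over an empty value of \<open>T\<close> is \<open>\<infinity>\<close>.\<close>

definition inf_pairing ::
    "('a::real_normed_vector \<Rightarrow> ('a \<Rightarrow>\<^sub>L real) set) \<Rightarrow> 'a \<Rightarrow> 'a \<Rightarrow> ereal" where
  "inf_pairing T x y = (INF ys\<in>T y. ereal (blinfun_apply ys (y - x)))"

text \<open>
  Nets in \<open>K\<close> are rendered by proper filters on the space that contain \<open>K\<close>: HOL cannot quantify
  over all index types inside a definition. The filter \<open>F\<close> plays the role of the eventuality
  filter of the net; that this is the same notion as the one with nets is proved below in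
  \<open>weakly_dually_lsc_onD_net\<close> (nets over an arbitrary index type) and
  \<open>weakly_dually_lsc_onI_net\<close> (nets over one sufficiently large index type suffice).
  The weak limit \<open>y\<close> is not required to lie in \<open>K\<close>.
\<close>

definition weakly_dually_lsc_on ::
    "('a::real_normed_vector \<Rightarrow> ('a \<Rightarrow>\<^sub>L real) set) \<Rightarrow> 'a set \<Rightarrow> bool" where
  "weakly_dually_lsc_on T K \<longleftrightarrow>
     (\<forall>x\<in>K. \<forall>y. \<forall>F. F \<noteq> bot \<longrightarrow> (\<forall>\<^sub>F z in F. z \<in> K) \<longrightarrow> weakly_tendsto (\<lambda>z. z) y F \<longrightarrow>
        Limsup F (inf_pairing T x) \<ge> 0 \<longrightarrow> inf_pairing T x y \<ge> 0)"

definition directed_set :: "'i set \<Rightarrow> ('i \<Rightarrow> 'i \<Rightarrow> bool) \<Rightarrow> bool" where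
  "directed_set I le \<longleftrightarrow> I \<noteq> {} \<and> (\<forall>i\<in>I. le i i) \<and>
     (\<forall>i\<in>I. \<forall>j\<in>I. \<forall>k\<in>I. le i j \<longrightarrow> le j k \<longrightarrow> le i k) \<and>
     (\<forall>i\<in>I. \<forall>j\<in>I. \<exists>k\<in>I. le i k \<and> le j k)"

definition tails :: "'i set \<Rightarrow> ('i \<Rightarrow> 'i \<Rightarrow> bool) \<Rightarrow> 'i filter" where
  "tails I le = (INF i\<in>I. principal {j\<in>I. le i j})"

lemma eventually_tails:
  assumes "directed_set I le"
  shows "eventually P (tails I le) \<longleftrightarrow> (\<exists>i\<in>I. \<forall>j\<in>I. le i j \<longrightarrow> P j)"
proof -
  have "eventually P (tails I le) \<longleftrightarrow> (\<exists>i\<in>I. eventually P (principal {j\<in>I. le i j}))"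
    unfolding tails_def
  proof (rule eventually_INF_base)
    show "I \<noteq> {}" using assms by (simp add: directed_set_def)
    fix a b assume ab: "a \<in> I" "b \<in> I"
    then obtain k where k: "k \<in> I" "le a k" "le b k"
      using assms unfolding directed_set_def by blast
    have "{j\<in>I. le k j} \<subseteq> {j\<in>I. le a j} \<inter> {j\<in>I. le b j}"
      using assms ab k unfolding directed_set_def by blast
    then show "\<exists>x\<in>I. principal {j \<in> I. le x j} \<le>
        inf (principal {j \<in> I. le a j}) (principal {j \<in> I. le b j})"
      using k(1) by (intro bexI[of _ k]) auto
  qed
  then show ?thesis by (auto simp: eventually_principal)
qed

lemma Limsup_tails:
  fixes g :: "'i \<Rightarrow> ereal"
  assumes "directed_set I le"
  shows "Limsup (tails I le) g = (INF i\<in>I. SUP j\<in>{j\<in>I. le i j}. g j)"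
proof (rule antisym)
  show "Limsup (tails I le) g \<le> (INF i\<in>I. SUP j\<in>{j\<in>I. le i j}. g j)"
  proof (rule INF_greatest)
    fix i assume "i \<in> I"
    then have "eventually (\<lambda>j. j \<in> {j\<in>I. le i j}) (tails I le)"
      by (auto simp: eventually_tails[OF assms])
    then show "Limsup (tails I le) g \<le> (SUP j\<in>{j\<in>I. le i j}. g j)"
      unfolding Limsup_def by (intro INF_lower2[of "\<lambda>j. j \<in> {j\<in>I. le i j}"]) auto
  qed
  show "(INF i\<in>I. SUP j\<in>{j\<in>I. le i j}. g j) \<le> Limsup (tails I le) g"
    unfolding Limsup_def
  proof (rule INF_greatest)
    fix P assume "P \<in> {P. eventually P (tails I le)}"
    then obtain i where i: "i \<in> I" "\<forall>j\<in>I. le i j \<longrightarrow> P j"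
      by (auto simp: eventually_tails[OF assms])
    then have "(SUP j\<in>{j\<in>I. le i j}. g j) \<le> (SUP j\<in>Collect P. g j)"
      by (intro SUP_subset_mono) auto
    then show "(INF i\<in>I. SUP j\<in>{j\<in>I. le i j}. g j) \<le> (SUP j\<in>Collect P. g j)"
      using i(1) by (rule INF_lower2[rotated])
  qed
qed

lemma Limsup_filtermap_comp:
  fixes g :: "'a \<Rightarrow> ereal"
  shows "Limsup (filtermap u F) g = Limsup F (\<lambda>i. g (u i))"
proof (rule antisym)
  show "Limsup (filtermap u F) g \<le> Limsup F (\<lambda>i. g (u i))"
    unfolding Limsup_def[of F]
  proof (rule INF_greatest)
    fix P assume "P \<in> {P. eventually P F}"
    then have "eventually P F" by simp
    then have "eventually (\<lambda>x. x \<in> u ` Collect P) (filtermap u F)"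
      unfolding eventually_filtermap by (rule eventually_mono) blast
    then have "Limsup (filtermap u F) g \<le> Sup (g ` Collect (\<lambda>x. x \<in> u ` Collect P))"
      unfolding Limsup_def by (intro INF_lower) simp
    then show "Limsup (filtermap u F) g \<le> (SUP i\<in>Collect P. g (u i))"
      by (simp add: image_image)
  qed
qed (rule Limsup_filtermap_ge)

lemma weakly_tendsto_filtermap:
  "weakly_tendsto (\<lambda>z. z) y (filtermap u F) \<longleftrightarrow> weakly_tendsto u y F"
  by (simp add: weakly_tendsto_def filterlim_filtermap)

lemma weakly_dually_lsc_onD_net:
  fixes I :: "'i set" and u :: "'i \<Rightarrow> 'a::real_normed_vector"
  assumes "weakly_dually_lsc_on T K" and "x \<in> K"
    and dir: "directed_set I le"
    and "\<forall>i\<in>I. u i \<in> K"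
    and "weakly_tendsto u y (tails I le)"
    and "(INF i\<in>I. SUP j\<in>{j\<in>I. le i j}. inf_pairing T x (u j)) \<ge> 0"
  shows "inf_pairing T x y \<ge> 0"
proof -
  let ?F = "filtermap u (tails I le)"
  have refl: "le i i" if "i \<in> I" for i
    using dir that by (simp add: directed_set_def)
  have "\<not> eventually (\<lambda>_. False) (tails I le)"
    unfolding eventually_tails[OF dir] using refl by blast
  then have "?F \<noteq> bot"
    unfolding trivial_limit_def eventually_filtermap .
  moreover have "\<forall>\<^sub>F z in ?F. z \<in> K"
  proof -
    obtain i where "i \<in> I" using dir unfolding directed_set_def by blast
    then show ?thesis
      unfolding eventually_filtermap eventually_tails[OF dir] using assms(4) by blast
  qed
  moreover have "weakly_tendsto (\<lambda>z. z) y ?F"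
    using assms(5) by (simp add: weakly_tendsto_filtermap)
  moreover have "Limsup ?F (inf_pairing T x) \<ge> 0"
    using assms(6) by (simp add: Limsup_filtermap_comp Limsup_tails[OF dir])
  ultimately show ?thesis
    using assms(1,2) unfolding weakly_dually_lsc_on_def by blast
qed

lemma weakly_dually_lsc_onI_net:
  fixes T :: "'a::real_normed_vector \<Rightarrow> ('a \<Rightarrow>\<^sub>L real) set"
  assumes net: "\<And>x y (I :: ('a set \<times> 'a) set) le u.
      x \<in> K \<Longrightarrow> directed_set I le \<Longrightarrow> \<forall>i\<in>I. u i \<in> K \<Longrightarrow> weakly_tendsto u y (tails I le) \<Longrightarrow>
      (INF i\<in>I. SUP j\<in>{j\<in>I. le i j}. inf_pairing T x (u j)) \<ge> 0 \<Longrightarrow> inf_pairing T x y \<ge> 0"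
  shows "weakly_dually_lsc_on T K"
  unfolding weakly_dually_lsc_on_def
proof (intro ballI allI impI)
  fix x y :: 'a and F
  assume x: "x \<in> K" and F: "F \<noteq> bot" and K: "\<forall>\<^sub>F z in F. z \<in> K"
    and lim: "weakly_tendsto (\<lambda>z. z) y F" and sup: "Limsup F (inf_pairing T x) \<ge> 0"
  define I where "I = {(A, a). a \<in> A \<and> A \<subseteq> K \<and> (\<forall>\<^sub>F z in F. z \<in> A)}"
  define le :: "'a set \<times> 'a \<Rightarrow> 'a set \<times> 'a \<Rightarrow> bool" where "le = (\<lambda>i j. fst j \<subseteq> fst i)"
  have ex: "\<exists>a. (A, a) \<in> I" if "A \<subseteq> K" "\<forall>\<^sub>F z in F. z \<in> A" for A
    using that eventually_happens'[OF F that(2)] by (auto simp: I_def)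
  have dir: "directed_set I le"
    unfolding directed_set_def
  proof (intro conjI ballI)
    show "I \<noteq> {}" using ex[of K] K by auto
    show "\<exists>k\<in>I. le i k \<and> le j k" if "i \<in> I" "j \<in> I" for i j
    proof -
      have "\<exists>a. (fst i \<inter> fst j, a) \<in> I"
        using that by (intro ex) (auto simp: I_def eventually_conj_iff)
      then obtain a where "(fst i \<inter> fst j, a) \<in> I" ..
      then show ?thesis by (rule bexI[rotated]) (auto simp: le_def)
    qed
  qed (auto simp: le_def)
  have F_eq: "filtermap snd (tails I le) = F"
  proof (rule filter_eq_iff[THEN iffD2], rule allI)
    fix P
    show "eventually P (filtermap snd (tails I le)) = eventually P F"
    proof
      assume "eventually P (filtermap snd (tails I le))"
      then obtain i where i: "i \<in> I" "\<forall>j\<in>I. le i j \<longrightarrow> P (snd j)"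
        by (auto simp: eventually_filtermap eventually_tails[OF dir])
      have "\<forall>\<^sub>F z in F. z \<in> fst i" using i(1) by (auto simp: I_def)
      moreover have "P z" if "z \<in> fst i" for z
        using i(2)[rule_format, of "(fst i, z)"] i(1) that by (auto simp: I_def le_def)
      ultimately show "eventually P F" by (rule eventually_mono)
    next
      assume "eventually P F"
      then obtain a where a: "({z\<in>K. P z}, a) \<in> I"
        using ex[of "{z\<in>K. P z}"] K by (auto simp: eventually_conj_iff)
      show "eventually P (filtermap snd (tails I le))"
        unfolding eventually_filtermap eventually_tails[OF dir]
        by (rule bexI[OF _ a]) (auto simp: I_def le_def)
    qed
  qed
  show "inf_pairing T x y \<ge> 0"
  proof (rule net[OF x dir])
    show "\<forall>i\<in>I. snd i \<in> K" by (auto simp: I_def)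
    show "weakly_tendsto snd y (tails I le)"
      using lim F_eq weakly_tendsto_filtermap[of y snd "tails I le"] by simp
    show "(INF i\<in>I. SUP j\<in>{j\<in>I. le i j}. inf_pairing T x (snd j)) \<ge> 0"
      using sup Limsup_filtermap_comp[of snd "tails I le" "inf_pairing T x"]
      by (simp add: F_eq Limsup_tails[OF dir])
  qed
qed

end

theory Submission
  imports Defs
begin

text \<open>
  Let \<open>x\<close> be a Stampacchia solution, witnessed by \<open>f \<in> T x\<close>, that violates the Minty inequality
  at some \<open>y\<close>. If \<open>f \<noteq> 0\<close>, then \<open>f (z - x) > 0\<close> for \<open>z\<close> in the algebraic interior, while
  \<open>f (y - x) \<ge> 0\<close>, so \<open>f (u - x) > 0\<close> for \<open>u\<close> on the segment from \<open>y\<close> (excluded) to \<open>z\<close>.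
  Quasimonotonicity then gives the Minty inequality on this segment, and lower semicontinuity
  carries it over to the end point \<open>y\<close>, a contradiction. Hence \<open>0 = f \<in> T x\<close>.
\<close>

text \<open>If \<open>f (z - x)\<close> were zero, a small step from \<open>z\<close> in any
  direction \<open>v\<close> would stay in \<open>K\<close> and force \<open>f v \<ge> 0\<close>.
  Applied to \<open>v\<close> and \<open>- v\<close>, this makes \<open>f\<close> vanish.\<close>

lemma blinfun_pos_on_cor:
  fixes f :: "'a::real_normed_vector \<Rightarrow>\<^sub>L real"
  assumes nonneg: "\<And>y. y \<in> K \<Longrightarrow> f (y - x) \<ge> 0"
    and z: "z \<in> cor K" and "f \<noteq> 0"
  shows "f (z - x) > 0"
proof (rule ccontr)
  assume "\<not> f (z - x) > 0"
  moreover have "z \<in> K" using z by (simp add: cor_def)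
  ultimately have fz: "f (z - x) = 0" using nonneg[of z] by linarith
  have ge: "f v \<ge> 0" for v
  proof -
    from z obtain l where l: "l > 0" "\<forall>t\<in>{0..<l}. z + t *\<^sub>R v \<in> K"
      unfolding cor_def by blast
    \<comment> \<open>The step is halved because \<open>l\<close> itself is excluded from the
      admissible range.\<close>
    have "f (z + (l/2) *\<^sub>R v - x) \<ge> 0" using l by (intro nonneg) auto
    then have "l/2 * f v \<ge> 0"
      using fz by (simp add: blinfun.add_right blinfun.diff_right blinfun.scaleR_right)
    then show ?thesis using l(1) by (simp add: zero_le_mult_iff)
  qed
  have "f v = 0" for v using ge[of v] ge[of "- v"] by (simp add: blinfun.minus_right)
  then have "f = 0" by (intro blinfun_eqI) simp
  with \<open>f \<noteq> 0\<close> show False ..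
qed

lemma tendsto_imp_weakly_tendsto:
  "(u \<longlongrightarrow> y) F \<Longrightarrow> weakly_tendsto u y F"
  unfolding weakly_tendsto_def by (intro allI blinfun.tendsto tendsto_const)

text \<open>Pushing \<open>F\<close> forward along \<open>u\<close> gives a filter on the space
  itself, as the definition demands. Since \<open>F\<close> is proper, eventual nonnegativity bounds
  the upper limit from below.\<close>

lemma weakly_dually_lsc_onD_tendsto:
  assumes "weakly_dually_lsc_on T K" and "x \<in> K" and "F \<noteq> bot"
    and "\<forall>\<^sub>F i in F. u i \<in> K" and "(u \<longlongrightarrow> y) F"
    and "\<forall>\<^sub>F i in F. inf_pairing T x (u i) \<ge> 0"
  shows "inf_pairing T x y \<ge> 0"
proof -
  have "filtermap u F \<noteq> bot" using assms(3) by (simp add: filtermap_bot_iff)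
  moreover have "\<forall>\<^sub>F z in filtermap u F. z \<in> K"
    using assms(4) by (simp add: eventually_filtermap)
  moreover have "weakly_tendsto (\<lambda>z. z) y (filtermap u F)"
    using assms(5) by (simp add: weakly_tendsto_filtermap tendsto_imp_weakly_tendsto)
  moreover have "Limsup (filtermap u F) (inf_pairing T x) \<ge> 0"
    using assms(3,6) by (simp add: Limsup_filtermap_comp le_Limsup)
  ultimately show ?thesis
    using assms(1,2) unfolding weakly_dually_lsc_on_def by blast
qed

theorem lemma3p8:
  fixes K :: "'a::banach set"
    and T :: "'a \<Rightarrow> ('a \<Rightarrow>\<^sub>L real) set"
  assumes "convex K"
    and "cor K \<noteq> {}"
    and "quasimonotone_on T K"
    and "weakly_dually_lsc_on T K"
    and "\<not> stampacchia T K \<subseteq> minty T K"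
  shows "\<exists>x. 0 \<in> T x"
proof -
  obtain x f where x: "x \<in> K" "x \<notin> minty T K" and f: "f \<in> T x"
    and f_ge: "\<And>y. y \<in> K \<Longrightarrow> blinfun_apply f (y - x) \<ge> 0"
    using assms(5) unfolding stampacchia_def by blast
  obtain y g where y: "y \<in> K" and g: "g \<in> T y" and gy: "blinfun_apply g (y - x) < 0"
    using x unfolding minty_def by force
  obtain z where z: "z \<in> cor K" using assms(2) by blast
  then have zK: "z \<in> K" by (simp add: cor_def)
  have quasi: "blinfun_apply b (q - p) \<ge> 0"
    if "p \<in> K" "q \<in> K" "a \<in> T p" "blinfun_apply a (q - p) > 0" "b \<in> T q" for p q a b
    using assms(3) that unfolding quasimonotone_on_def by blast
  have "f = 0"
  proof (rule ccontr)
    assume "f \<noteq> 0"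
    with f_ge z have fz: "blinfun_apply f (z - x) > 0" by (rule blinfun_pos_on_cor)
    define u where "u t = y + t *\<^sub>R (z - y)" for t
    have uK: "u t \<in> K" if "0 < t" "t < 1" for t
      using convexD_alt[OF assms(1) y zK, of t] that by (simp add: u_def algebra_simps)
    have minty_u: "inf_pairing T x (u t) \<ge> 0" if t: "0 < t" "t < 1" for t
    proof -
      have "u t - x = (1 - t) *\<^sub>R (y - x) + t *\<^sub>R (z - x)"
        by (simp add: u_def algebra_simps)
      then have "blinfun_apply f (u t - x) =
          (1 - t) * blinfun_apply f (y - x) + t * blinfun_apply f (z - x)"
        by (simp add: blinfun.add_right blinfun.scaleR_right)
      also have "\<dots> > 0"
        using t fz f_ge[OF y] by (intro add_nonneg_pos mult_nonneg_nonneg mult_pos_pos) auto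
      \<comment> \<open>An empty \<open>T (u t)\<close> needs no separate case, its infimum being
        infinite.\<close>
      finally show ?thesis
        using quasi[OF x(1) uK[OF t] f] unfolding inf_pairing_def by (intro INF_greatest) simp
    qed
    have ev: "\<forall>\<^sub>F t in at_right (0::real). 0 < t \<and> t < 1"
      unfolding eventually_at_right_field by (intro exI[of _ 1]) simp
    \<comment> \<open>The limit \<open>y\<close> is left unsimplified so that it matches the shape
      produced by \<open>tendsto_intros\<close>.\<close>
    have "(u \<longlongrightarrow> y + 0 *\<^sub>R (z - y)) (at_right 0)"
      unfolding u_def by (intro tendsto_intros)
    then have "inf_pairing T x y \<ge> 0"
      using ev uK minty_u
      by (intro weakly_dually_lsc_onD_tendsto[OF assms(4) x(1) trivial_limit_at_right_real[of 0], of u])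
        (auto elim: eventually_mono)
    moreover have "inf_pairing T x y \<le> ereal (blinfun_apply g (y - x))"
      unfolding inf_pairing_def using g by (rule INF_lower)
    ultimately have "0 \<le> ereal (blinfun_apply g (y - x))" by (rule order_trans)
    with gy show False by simp
  qed
  with f show ?thesis by blast
qed

end
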